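(* A sofic shift $X$ satisfies Condition $(\ast)$ if and only if the left Krieger cover of $X$ is the maximal essential subgraph of the past set cover of $X$. Here Condition $(\ast)$ is the following: for every $l\in\mathbb{N}$ and every infinite $F\subseteq\mathcal{B}(X)$ such that $P_l(u)=P_l(v)$ for all $u,v\in F$, there exists $x^+\in X^+$ such that $P_l(w)=P_l(x^+)$ for all $w\in F$.
   Context: A shift space is a closed subset $X\subseteq\mathcal{A}^{\mathbb{Z}}$ ($\mathcal{A}$ a finite discrete alphabet, product topology) invariant under the shift $\sigma(x)_i=x_{i+1}$. It is sofic if it is the image of a shift of finite type under a continuous shift-commuting map. $\mathcal{B}(X)$ is the set of (nonempty) finite words occurring in elements of $X$. $X^+=\{x_0x_1x_2\cdots : x\in X\}$ and $X^-=\{\cdots x_{-2}x_{-1} : x\in X\}$. For $x^+\in X^+$, $P_\infty(x^+)=\{y^-\in X^- : y^-x^+\in X\}$; for $w\in\mathcal{B}(X)$, $P_\infty(w)=\{y^-\in X^- : y^-w\in X^-\}$. For $l\in\mathbb{N}$ and $w\in\mathcal{B}(X)$, $P_l(w)=\{v\in\mathcal{B}(X) : vw\in\mathcal{B}(X),\ |v|\leq l\}$; for $x^+\in X^+$, $P_l(x^+)=\{v\in\mathcal{B}(X) : vx^+\in X^+,\ |v|\leq l\}$. The left Krieger cover $(K,\mathcal{L}_K)$ of $X$ is the labelled directed graph with vertex set $K^0=\{P_\infty(x^+) : x^+\in X^+\}$ which has an edge labelled $a\in\mathcal{A}$ from $P$ to $P'$ if and only if there is $x^+\in X^+$ with $ax^+\in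 X^+$, $P=P_\infty(ax^+)$ and $P'=P_\infty(x^+)$. The past set cover $(W,\mathcal{L}_W)$ is the labelled directed graph with vertex set $W^0=\{P_\infty(w) : w\in\mathcal{B}(X)\}$ which has an edge labelled $a$ from $P$ to $P'$ if and only if there is $w\in\mathcal{B}(X)$ with $aw\in\mathcal{B}(X)$, $P=P_\infty(aw)$ and $P'=P_\infty(w)$. Both are finite since $X$ is sofic. For sofic $X$ one has $K^0\subseteq W^0$ (as sets of subsets of $X^-$), and the left Krieger cover is in this way regarded as a labelled subgraph of the past set cover. A graph (in particular a subgraph) is essential if every one of its vertices emits and receives an edge belonging to it; the maximal essential subgraph of a finite graph is its largest essential subgraph. *)

theory Defs
  imports
    "HOL-Analysis.Function_Topology"
    "HOL-Library.Omega_Words_Fun"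
    "Graph_Theory.Digraph_Component"
begin

subsection \<open>Shift spaces\<close>

definition full_shift :: "'a set \<Rightarrow> (int \<Rightarrow> 'a) topology" where
  "full_shift A = product_topology (\<lambda>_. discrete_topology A) UNIV"

definition shift_map :: "(int \<Rightarrow> 'a) \<Rightarrow> (int \<Rightarrow> 'a)" where
  "shift_map x = (\<lambda>i. x (i + 1))"

definition shift_space :: "'a set \<Rightarrow> (int \<Rightarrow> 'a) set \<Rightarrow> bool" where
  "shift_space A X \<longleftrightarrow> finite A \<and> closedin (full_shift A) X \<and> shift_map ` X = X"

definition occurs_in :: "'a list \<Rightarrow> (int \<Rightarrow> 'a) \<Rightarrow> bool" where
  "occurs_in w x \<longleftrightarrow> (\<exists>i. \<forall>k < length w. w ! k = x (i + int k))"

definition shift_of_finite_type :: "'a set \<Rightarrow> (int \<Rightarrow> 'a) set \<Rightarrow> bool" where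
  "shift_of_finite_type A X \<longleftrightarrow> finite A \<and>
     (\<exists>F. finite F \<and> F \<subseteq> lists A \<and>
        X = {x \<in> topspace (full_shift A). \<forall>w \<in> F. \<not> occurs_in w x})"

text \<open>The existential over the alphabet of the shift of finite type cannot range over types. Since
  every finite alphabet is in bijection with a finite set of natural numbers, alphabets
  \<open>B :: nat set\<close> lose no generality.\<close>

definition sofic_shift :: "'a set \<Rightarrow> (int \<Rightarrow> 'a) set \<Rightarrow> bool" where
  "sofic_shift A X \<longleftrightarrow> shift_space A X \<and>
     (\<exists>(B :: nat set) Y \<phi>. shift_of_finite_type B Y \<and>
        continuous_map (subtopology (full_shift B) Y) (full_shift A) \<phi> \<and>
        (\<forall>y \<in> Y. \<phi> (shift_map y) = shift_map (\<phi> y)) \<and>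
        \<phi> ` Y = X)"


subsection \<open>Words, rays and predecessor sets\<close>

definition language :: "(int \<Rightarrow> 'a) set \<Rightarrow> 'a list set" where
  "language X = {w. w \<noteq> [] \<and> (\<exists>x \<in> X. occurs_in w x)}"

definition right_ray :: "(int \<Rightarrow> 'a) \<Rightarrow> 'a word" where
  "right_ray x = (\<lambda>n. x (int n))"

text \<open>A left-infinite sequence \<open>\<dots> y\<^sub>-\<^sub>2 y\<^sub>-\<^sub>1\<close> is stored from right to left: its entry at position
  \<open>-(n + 1)\<close> is the value at \<open>n\<close>. Consequently \<open>y\<^sup>- w\<close> is \<open>rev w \<frown> y\<close>.\<close>

definition left_ray :: "(int \<Rightarrow> 'a) \<Rightarrow> 'a word" where
  "left_ray x = (\<lambda>n. x (- int n - 1))"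

definition glue :: "'a word \<Rightarrow> 'a word \<Rightarrow> (int \<Rightarrow> 'a)" where
  "glue y x = (\<lambda>i. if i \<ge> 0 then x (nat i) else y (nat (- i - 1)))"

lemma glue_left_ray_right_ray [simp]: "glue (left_ray x) (right_ray x) = x"
  by (auto simp: glue_def left_ray_def right_ray_def fun_eq_iff)

definition right_rays :: "(int \<Rightarrow> 'a) set \<Rightarrow> 'a word set" where
  "right_rays X = right_ray ` X"

definition left_rays :: "(int \<Rightarrow> 'a) set \<Rightarrow> 'a word set" where
  "left_rays X = left_ray ` X"

definition past_ray :: "(int \<Rightarrow> 'a) set \<Rightarrow> 'a word \<Rightarrow> 'a word set" where
  "past_ray X x = {y \<in> left_rays X. glue y x \<in> X}"

definition past_word :: "(int \<Rightarrow> 'a) set \<Rightarrow> 'a list \<Rightarrow> 'a word set" where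
  "past_word X w = {y \<in> left_rays X. rev w \<frown> y \<in> left_rays X}"

definition lpast_ray :: "(int \<Rightarrow> 'a) set \<Rightarrow> nat \<Rightarrow> 'a word \<Rightarrow> 'a list set" where
  "lpast_ray X l x = {v \<in> language X. v \<frown> x \<in> right_rays X \<and> length v \<le> l}"

definition lpast_word :: "(int \<Rightarrow> 'a) set \<Rightarrow> nat \<Rightarrow> 'a list \<Rightarrow> 'a list set" where
  "lpast_word X l w = {v \<in> language X. v @ w \<in> language X \<and> length v \<le> l}"

definition condition_star :: "(int \<Rightarrow> 'a) set \<Rightarrow> bool" where
  "condition_star X \<longleftrightarrow>
     (\<forall>l F. F \<subseteq> language X \<and> infinite F \<and>
            (\<forall>u \<in> F. \<forall>v \<in> F. lpast_word X l u = lpast_word X l v) \<longrightarrow>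
        (\<exists>x \<in> right_rays X. \<forall>w \<in> F. lpast_word X l w = lpast_ray X l x))"


subsection \<open>Labelled graphs\<close>

text \<open>Labelled graphs are digraphs whose arcs are triples (source, label, target), so that a
  subgraph automatically inherits the labels.\<close>

type_synonym ('v, 'a) labelled_graph = "('v, 'v \<times> 'a \<times> 'v) pre_digraph"

definition labelled_graph ::
  "'v set \<Rightarrow> ('v \<times> 'a \<times> 'v) set \<Rightarrow> ('v, 'a) labelled_graph" where
  "labelled_graph V E =
     \<lparr>verts = V, arcs = E, tail = (\<lambda>(p, a, q). p), head = (\<lambda>(p, a, q). q)\<rparr>"

definition left_krieger_cover :: "(int \<Rightarrow> 'a) set \<Rightarrow> ('a word set, 'a) labelled_graph" where
  "left_krieger_cover X = labelled_graph
     (past_ray X ` right_rays X)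
     {(past_ray X ([a] \<frown> x), a, past_ray X x) | a x.
        x \<in> right_rays X \<and> [a] \<frown> x \<in> right_rays X}"

definition past_set_cover :: "(int \<Rightarrow> 'a) set \<Rightarrow> ('a word set, 'a) labelled_graph" where
  "past_set_cover X = labelled_graph
     (past_word X ` language X)
     {(past_word X (a # w), a, past_word X w) | a w.
        w \<in> language X \<and> a # w \<in> language X}"

definition essential :: "('v, 'e) pre_digraph \<Rightarrow> bool" where
  "essential G \<longleftrightarrow> (\<forall>v \<in> verts G. out_arcs G v \<noteq> {} \<and> in_arcs G v \<noteq> {})"

definition is_maximal_essential_subgraph ::
  "('v, 'e) pre_digraph \<Rightarrow> ('v, 'e) pre_digraph \<Rightarrow> bool" where
  "is_maximal_essential_subgraph H G \<longleftrightarrow>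
     subgraph H G \<and> essential H \<and>
     (\<forall>H'. subgraph H' G \<and> essential H' \<longrightarrow> subgraph H' H)"

end

theory Submission
  imports Defs
begin

text \<open>
  Both sides of the equivalence say the same thing about the \<^emph>\<open>recurrent\<close> past sets, the sets
  \<open>P\<close> that are the past set of infinitely many words: each of them is the past set of a ray.

  A sofic shift has only finitely many past sets of words (\<open>sofic_finite_past_words\<close>), because
  \<open>P\<^sub>\<infinity>(w)\<close> depends only on the finite windows around the origin that preimages of points carrying
  \<open>w\<close> can show; of soficity, only this finiteness enters the rest of the argument. Since
  \<open>P\<^sub>\<infinity>(aw) = {y. ya \<in> P\<^sub>\<infinity>(w)}\<close>, and likewise for rays, the past set of an extension depends only on
  the letter and on the past set being extended. By compactness \<open>P\<^sub>\<infinity>(x\<^sup>+)\<close> is the intersection of the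
  past sets of the prefixes of \<open>x\<^sup>+\<close>; these decrease and take finitely many values, so \<open>P\<^sub>\<infinity>(x\<^sup>+)\<close>
  equals \<open>P\<^sub>\<infinity>\<close> of every long prefix. Hence the left Krieger cover is a subgraph of the past set cover,
  and it is essential because rays can be extended and shortened on the left.

  \<^emph>\<open>The graph side\<close> (\<open>maximal_essential_iff\<close>). The recurrent past sets are the vertices of the
  largest essential subgraph. In an essential subgraph one can follow edges forward for \<open>n\<close> steps,
  so each vertex is the past set of words of length at least \<open>n\<close>, for every \<open>n\<close>, and is recurrent.
  Conversely the recurrent past sets span an essential subgraph: stripping or adding one letter turns
  an infinite family of words with a common past set into another one, by the pigeonhole principle.
  An edge into a vertex of the Krieger cover is an edge of the Krieger cover, so only vertices matter.

  \<^emph>\<open>Condition \<open>(\<ast>)\<close>\<close> (\<open>condition_star_iff\<close>). An infinite set of words has a member with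
  recurrent past set; if that is the past set of a ray, this ray serves the whole family. Conversely,
  apply the condition for each \<open>l\<close> to all words with a given recurrent past set. Finitely many past
  sets of rays are available, so one of them works for infinitely many \<open>l\<close>, hence for all \<open>l\<close>; and
  the \<open>P\<^sub>l\<close> for all \<open>l\<close> together determine the past set, again by compactness.
\<close>

section \<open>The topology of the full shift\<close>

lemma topspace_full_shift: "topspace (full_shift A) = {x. range x \<subseteq> A}"
  by (auto simp: full_shift_def PiE_iff)

text \<open>
  The central cylinders form a neighbourhood basis, so topological statements about the full shift
  become statements about agreement on symmetric windows.
\<close>

lemma openin_full_shift_iff:
  "openin (full_shift A) U \<longleftrightarrow>
     U \<subseteq> topspace (full_shift A) \<and>
     (\<forall>y\<in>U. \<exists>r::nat. \<forall>z\<in>topspace (full_shift A). (\<forall>i\<in>{- int r..int r}. z i = y i) \<longrightarrow> z \<in> U)"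
    (is "?L \<longleftrightarrow> ?R")
proof
  assume op: ?L
  show ?R
  proof (intro conjI ballI)
    show "U \<subseteq> topspace (full_shift A)" using op by (rule openin_subset)
    fix y assume y: "y \<in> U"
    with op obtain V where fin: "finite {i. V i \<noteq> A}" and yV: "y \<in> Pi\<^sub>E UNIV V"
      and sub: "Pi\<^sub>E UNIV V \<subseteq> U"
      unfolding full_shift_def openin_product_topology_alt by auto
    define r where "r = Max (insert 0 ((\<lambda>i. nat \<bar>i\<bar>) ` {i. V i \<noteq> A}))"
    have r: "nat \<bar>i\<bar> \<le> r" if "V i \<noteq> A" for i
      unfolding r_def using fin that by (intro Max_ge) auto
    have "z \<in> U" if z: "z \<in> topspace (full_shift A)" "\<forall>i\<in>{- int r..int r}. z i = y i" for z
    proof -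
      have "z i \<in> V i" for i
      proof (cases "V i = A")
        case True
        then show ?thesis using z(1) by (auto simp: topspace_full_shift)
      next
        case False
        then have "i \<in> {- int r..int r}" using r[of i] by auto
        then show ?thesis using z(2) yV by (auto simp: PiE_iff)
      qed
      then show ?thesis using sub by (auto simp: PiE_iff)
    qed
    then show "\<exists>r::nat. \<forall>z\<in>topspace (full_shift A). (\<forall>i\<in>{- int r..int r}. z i = y i) \<longrightarrow> z \<in> U"
      by blast
  qed
next
  assume R: ?R
  show ?L
    unfolding full_shift_def openin_product_topology_alt
  proof (intro ballI)
    fix y assume y: "y \<in> U"
    then obtain r :: nat
      where r: "\<And>z. z \<in> topspace (full_shift A) \<Longrightarrow> \<forall>i\<in>{- int r..int r}. z i = y i \<Longrightarrow> z \<in> U"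
      using R by meson
    have yA: "range y \<subseteq> A" using y R by (auto simp: topspace_full_shift)
    define V where "V = (\<lambda>i. if i \<in> {- int r..int r} then {y i} else A)"
    have fin: "finite {i. V i \<noteq> A}"
      by (rule finite_subset[of _ "{- int r..int r}"]) (auto simp: V_def)
    have "Pi\<^sub>E UNIV V \<subseteq> U"
    proof
      fix z assume z: "z \<in> Pi\<^sub>E UNIV V"
      have zV: "z i \<in> V i" for i using z by (auto simp: PiE_iff)
      have "z i \<in> A" for i using zV[of i] yA by (auto simp: V_def split: if_splits)
      moreover have "\<forall>i\<in>{- int r..int r}. z i = y i"
      proof
        fix i assume "i \<in> {- int r..int r}"
        then show "z i = y i" using zV[of i] by (simp add: V_def)
      qed
      ultimately show "z \<in> U" by (intro r) (auto simp: topspace_full_shift)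
    qed
    moreover have "y \<in> Pi\<^sub>E UNIV V" "\<forall>i. V i \<subseteq> A" using yA by (auto simp: V_def)
    ultimately show "\<exists>V. finite {i \<in> UNIV. V i \<noteq> topspace (discrete_topology A)} \<and>
        (\<forall>i\<in>UNIV. openin (discrete_topology A) (V i)) \<and> y \<in> Pi\<^sub>E UNIV V \<and> Pi\<^sub>E UNIV V \<subseteq> U"
      using fin by (intro exI[of _ V]) auto
  qed
qed

lemma closedin_full_shift_iff:
  "closedin (full_shift A) C \<longleftrightarrow>
     C \<subseteq> topspace (full_shift A) \<and>
     (\<forall>y\<in>topspace (full_shift A) - C. \<exists>r::nat. \<forall>z\<in>C. \<exists>i\<in>{- int r..int r}. z i \<noteq> y i)"
proof (cases "C \<subseteq> topspace (full_shift A)")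
  case True
  have "(\<forall>z\<in>topspace (full_shift A). (\<forall>i\<in>{- int r..int r}. z i = y i) \<longrightarrow> z \<in> topspace (full_shift A) - C)
      \<longleftrightarrow> (\<forall>z\<in>C. \<exists>i\<in>{- int r..int r}. z i \<noteq> y i)" for r :: nat and y
    using True by blast
  with True show ?thesis by (simp only: closedin_def openin_full_shift_iff Diff_subset simp_thms)
qed (simp add: closedin_def)

lemma compact_full_shift: "finite A \<Longrightarrow> compact_space (full_shift A)"
  unfolding full_shift_def
  by (simp add: compact_space_product_topology compact_space_discrete_topology)

section \<open>Shift spaces\<close>

locale shift_system =
  fixes A :: "'a set" and X :: "(int \<Rightarrow> 'a) set"
  assumes shift_space: "shift_space A X"
begin

lemma finite_alphabet: "finite A"
  and closed: "closedin (full_shift A) X"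
  and shift_map_image: "shift_map ` X = X"
  using shift_space by (auto simp: shift_space_def)

lemma in_alphabet: "x \<in> X \<Longrightarrow> x i \<in> A"
  using closedin_subset[OF closed] by (auto simp: topspace_full_shift)

lemma translate:
  assumes "x \<in> X"
  shows "(\<lambda>i. x (i + n)) \<in> X"
proof -
  have "\<forall>x\<in>X. (\<lambda>i. x (i + int k)) \<in> X" for k
  proof (induction k)
    case (Suc k)
    show ?case
    proof
      fix x assume "x \<in> X"
      then have "shift_map x \<in> X" using shift_map_image by blast
      from Suc[rule_format, OF this] show "(\<lambda>i. x (i + int (Suc k))) \<in> X"
        by (simp add: shift_map_def algebra_simps)
    qed
  qed simp
  moreover have "\<forall>x\<in>X. (\<lambda>i. x (i - int k)) \<in> X" for k
  proof (induction k)
    case (Suc k)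
    show ?case
    proof
      fix x assume "x \<in> X"
      then obtain u where u: "u \<in> X" "x = shift_map u" using shift_map_image by blast
      from u(2) have "(\<lambda>i. x (i - int (Suc k))) = (\<lambda>i. u (i - int k))"
        by (simp add: shift_map_def)
      with Suc u(1) show "(\<lambda>i. x (i - int (Suc k))) \<in> X" by simp
    qed
  qed simp
  ultimately show ?thesis
    using assms by (cases n rule: int_cases2) (auto)
qed

lemma translate_iff: "(\<lambda>i. x (i + n)) \<in> X \<longleftrightarrow> x \<in> X"
  using translate[of x n] translate[of "\<lambda>i. x (i + n)" "- n"] by auto

text \<open>
  The form in which compactness is used throughout: patterns that can be realised on each stage of
  an increasing sequence of windows can be realised on all stages at once.
\<close>

lemma point_agreeing_on_Union:
  fixes S :: "nat \<Rightarrow> int set"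
  assumes "incseq S" and "\<And>n. \<exists>x\<in>X. \<forall>i\<in>S n. x i = z i"
  shows "\<exists>x\<in>X. \<forall>n. \<forall>i\<in>S n. x i = z i"
proof -
  define C where "C = (\<lambda>n. {x\<in>X. \<forall>i\<in>S n. x i = z i})"
  have "closedin (full_shift A) (C n)" for n
  proof -
    have "closedin (full_shift A) {x \<in> topspace (full_shift A). \<forall>i\<in>S n. x i = z i}"
      unfolding closedin_full_shift_iff
    proof (intro conjI ballI)
      fix y
      assume "y \<in> topspace (full_shift A) - {x \<in> topspace (full_shift A). \<forall>i\<in>S n. x i = z i}"
      then obtain i where i: "i \<in> S n" "y i \<noteq> z i" by auto
      show "\<exists>r::nat. \<forall>x\<in>{x \<in> topspace (full_shift A). \<forall>i\<in>S n. x i = z i}.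
              \<exists>i\<in>{- int r..int r}. x i \<noteq> y i"
        using i by (intro exI[of _ "nat \<bar>i\<bar>"] ballI bexI[of _ i]) auto
    qed auto
    moreover have "C n = X \<inter> {x \<in> topspace (full_shift A). \<forall>i\<in>S n. x i = z i}"
      using closedin_subset[OF closed] by (auto simp: C_def)
    ultimately show ?thesis using closed by auto
  qed
  moreover have "C n \<noteq> {}" for n using assms(2)[of n] by (auto simp: C_def)
  moreover have "decseq C"
    using assms(1) by (fastforce simp: C_def decseq_def incseq_def)
  ultimately have "(\<Inter>n. C n) \<noteq> {}"
    using compact_space_imp_nest[OF compact_full_shift[OF finite_alphabet]] by blast
  then show ?thesis by (auto simp: C_def)
qed

end

section \<open>Sofic shifts have finitely many past sets\<close>

lemma shift_space_of_finite_type: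
  assumes "shift_of_finite_type B Y"
  shows "shift_space B Y"
proof -
  from assms obtain F where fin: "finite B"
    and Y: "Y = {x \<in> topspace (full_shift B). \<forall>w \<in> F. \<not> occurs_in w x}"
    by (auto simp: shift_of_finite_type_def)
  have occ: "occurs_in w (\<lambda>i. x (i + n)) \<longleftrightarrow> occurs_in w x" for w :: "'a list" and x n
  proof
    assume "occurs_in w (\<lambda>i. x (i + n))"
    then obtain i where "\<forall>k<length w. w ! k = x (i + int k + n)" by (auto simp: occurs_in_def)
    then show "occurs_in w x"
      unfolding occurs_in_def by (intro exI[of _ "i + n"]) (simp add: algebra_simps)
  next
    assume "occurs_in w x"
    then obtain i where "\<forall>k<length w. w ! k = x (i + int k)" by (auto simp: occurs_in_def)
    then show "occurs_in w (\<lambda>i. x (i + n))"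
      unfolding occurs_in_def by (intro exI[of _ "i - n"]) (simp add: algebra_simps)
  qed
  have tr: "(\<lambda>i. x (i + n)) \<in> Y" if "x \<in> Y" for x n
    using that occ[of _ x n] by (auto simp: Y topspace_full_shift)
  have "shift_map ` Y = Y"
  proof
    show "shift_map ` Y \<subseteq> Y" using tr[of _ 1] by (auto simp: shift_map_def)
    show "Y \<subseteq> shift_map ` Y"
    proof
      fix x assume "x \<in> Y"
      then have "(\<lambda>i. x (i + (-1))) \<in> Y" by (rule tr)
      then show "x \<in> shift_map ` Y" by (rule rev_image_eqI) (simp add: shift_map_def)
    qed
  qed
  moreover have "closedin (full_shift B) Y"
    unfolding closedin_full_shift_iff
  proof (intro conjI ballI)
    fix y assume y: "y \<in> topspace (full_shift B) - Y"
    then obtain w where w: "w \<in> F" "occurs_in w y" by (auto simp: Y)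
    then obtain i where i: "\<forall>k<length w. w ! k = y (i + int k)" by (auto simp: occurs_in_def)
    define r where "r = nat \<bar>i\<bar> + length w"
    have "\<exists>j\<in>{- int r..int r}. z j \<noteq> y j" if "z \<in> Y" for z
    proof (rule ccontr)
      assume "\<not> ?thesis"
      then have eq: "\<forall>j\<in>{- int r..int r}. z j = y j" by auto
      have "w ! k = z (i + int k)" if "k < length w" for k
      proof -
        have "i + int k \<in> {- int r..int r}" using that by (auto simp: r_def)
        then show ?thesis using eq i that by simp
      qed
      then have "occurs_in w z" by (auto simp: occurs_in_def)
      then show False using \<open>z \<in> Y\<close> w(1) by (auto simp: Y)
    qed
    then show "\<exists>r::nat. \<forall>z\<in>Y. \<exists>j\<in>{- int r..int r}. z j \<noteq> y j" by blast
  qed (auto simp: Y)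
  ultimately show ?thesis using fin by (simp add: shift_space_def)
qed

text \<open>
  The substantial half of the Curtis--Hedlund--Lyndon theorem. Continuity makes the coordinate at
  \<open>0\<close> of \<open>\<phi> y\<close> locally constant in \<open>y\<close>, compactness makes the radius uniform, and equivariance
  carries it to all coordinates.
\<close>

lemma sliding_block_code:
  fixes \<phi> :: "(int \<Rightarrow> 'b) \<Rightarrow> (int \<Rightarrow> 'a)"
  assumes "shift_space B Y" and cont: "continuous_map (subtopology (full_shift B) Y) (full_shift A) \<phi>"
    and comm: "\<And>y. y \<in> Y \<Longrightarrow> \<phi> (shift_map y) = shift_map (\<phi> y)"
  obtains r :: nat
  where "\<And>y y' i. \<lbrakk>y \<in> Y; y' \<in> Y; \<forall>j\<in>{i - int r..i + int r}. y j = y' j\<rbrakk> \<Longrightarrow> \<phi> y i = \<phi> y' i"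
proof -
  interpret Y: shift_system B Y by standard fact
  have Ytop: "Y \<subseteq> topspace (full_shift B)" by (rule closedin_subset[OF Y.closed])
  \<comment> \<open>The points at which the radius \<open>r\<close> fails. These sets are closed and decreasing, so if none
    were empty they would have a common point, contradicting local constancy there.\<close>
  define C where "C = (\<lambda>r::nat. {y\<in>Y. \<exists>y'\<in>Y. (\<forall>j\<in>{- int r..int r}. y j = y' j) \<and> \<phi> y 0 \<noteq> \<phi> y' 0})"
  have locally_constant:
    "\<exists>r::nat. \<forall>z\<in>Y. (\<forall>j\<in>{- int r..int r}. z j = y j) \<longrightarrow> \<phi> z 0 = \<phi> y 0" if y: "y \<in> Y" for y
  proof -
    have \<phi>y: "\<phi> y \<in> topspace (full_shift A)"
      using cont y Ytop by (auto simp: continuous_map_def)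
    have "openin (full_shift A) {x \<in> topspace (full_shift A). x 0 = \<phi> y 0}"
      unfolding openin_full_shift_iff by (auto intro!: exI[of _ "0::nat"])
    from openin_continuous_map_preimage[OF cont this]
    obtain U where U: "openin (full_shift B) U"
      "{z \<in> topspace (subtopology (full_shift B) Y). \<phi> z \<in> {x \<in> topspace (full_shift A). x 0 = \<phi> y 0}} = U \<inter> Y"
      unfolding openin_subtopology by blast
    have "y \<in> U" using U(2) y \<phi>y Ytop by auto
    then obtain r :: nat
      where "\<forall>z\<in>topspace (full_shift B). (\<forall>j\<in>{- int r..int r}. z j = y j) \<longrightarrow> z \<in> U"
      using U(1) unfolding openin_full_shift_iff by blast
    then show ?thesis using Ytop U(2) by (intro exI[of _ r]) blast
  qed
  have "\<exists>r. C r = {}"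
  proof (rule ccontr)
    assume "\<not> ?thesis"
    then have ne: "C r \<noteq> {}" for r by auto
    have "closedin (full_shift B) (C r)" for r
      unfolding closedin_full_shift_iff
    proof (intro conjI ballI)
      show "C r \<subseteq> topspace (full_shift B)" using Ytop by (auto simp: C_def)
      fix y assume y: "y \<in> topspace (full_shift B) - C r"
      show "\<exists>s::nat. \<forall>z\<in>C r. \<exists>j\<in>{- int s..int s}. z j \<noteq> y j"
      proof (cases "y \<in> Y")
        case False
        with y obtain s :: nat where "\<forall>z\<in>Y. \<exists>j\<in>{- int s..int s}. z j \<noteq> y j"
          using Y.closed unfolding closedin_full_shift_iff by blast
        then show ?thesis unfolding C_def by blast
      next
        case True
        from locally_constant[OF True] obtain s :: nat
          where s: "\<And>z. z \<in> Y \<Longrightarrow> \<forall>j\<in>{- int s..int s}. z j = y j \<Longrightarrow> \<phi> z 0 = \<phi> y 0"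
          by blast
        have "\<exists>j\<in>{- int (r + s)..int (r + s)}. z j \<noteq> y j" if "z \<in> C r" for z
        proof (rule ccontr)
          assume "\<not> ?thesis"
          then have z: "\<forall>j\<in>{- int (r + s)..int (r + s)}. z j = y j" by blast
          from that obtain z' where z': "z \<in> Y" "z' \<in> Y" "\<forall>j\<in>{- int r..int r}. z j = z' j"
            "\<phi> z 0 \<noteq> \<phi> z' 0" by (auto simp: C_def)
          have "\<forall>j\<in>{- int s..int s}. z j = y j" using z by auto
          with z'(1) have "\<phi> z 0 = \<phi> y 0" by (rule s)
          moreover have "\<forall>j\<in>{- int r..int r}. y j = z' j"
          proof
            fix j assume j: "j \<in> {- int r..int r}"
            then have "z j = y j" using z by auto
            with z'(3) j show "y j = z' j" by auto
          qed
          ultimately have "y \<in> C r" using True z' by (auto simp: C_def)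
          with y show False by simp
        qed
        then show ?thesis by blast
      qed
    qed
    moreover have "decseq C"
      unfolding decseq_def
    proof (intro allI impI)
      fix r s :: nat assume "r \<le> s"
      then have "{- int r..int r} \<subseteq> {- int s..int s}" by auto
      then show "C s \<subseteq> C r" unfolding C_def by blast
    qed
    ultimately have "(\<Inter>r. C r) \<noteq> {}"
      using compact_space_imp_nest[OF compact_full_shift[OF Y.finite_alphabet]] ne by blast
    then obtain y where y: "\<And>r. y \<in> C r" by auto
    then have "y \<in> Y" by (auto simp: C_def)
    from locally_constant[OF this] obtain r :: nat
      where r: "\<forall>z\<in>Y. (\<forall>j\<in>{- int r..int r}. z j = y j) \<longrightarrow> \<phi> z 0 = \<phi> y 0" by blast
    from y[of r] obtain y' where "y' \<in> Y" "\<forall>j\<in>{- int r..int r}. y j = y' j" "\<phi> y 0 \<noteq> \<phi> y' 0"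
      unfolding C_def by blast
    with r show False by (metis (no_types))
  qed
  then obtain r where r: "C r = {}" by blast
  have shift_nat: "\<phi> (\<lambda>j. y (j + int k)) = (\<lambda>j. \<phi> y (j + int k))" if "y \<in> Y" for y k
  proof (induction k)
    case (Suc k)
    have "\<phi> (shift_map (\<lambda>j. y (j + int k))) = shift_map (\<phi> (\<lambda>j. y (j + int k)))"
      using that by (intro comm Y.translate)
    with Suc show ?case by (simp add: shift_map_def algebra_simps)
  qed simp
  have shift_int: "\<phi> (\<lambda>j. y (j + n)) 0 = \<phi> y n" if y: "y \<in> Y" for y n
  proof (cases n rule: int_cases2)
    case (nonneg k)
    then show ?thesis using shift_nat[OF y, of k] by simp
  next
    case (nonpos k)
    then show ?thesis using shift_nat[OF Y.translate[OF y, of n], of k] by (simp add: fun_eq_iff)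
  qed
  show ?thesis
  proof (rule that[of r])
    fix y y' i assume y: "y \<in> Y" "y' \<in> Y" "\<forall>j\<in>{i - int r..i + int r}. y j = y' j"
    have "(\<lambda>j. y (j + i)) \<notin> C r" using r by simp
    then have "\<phi> (\<lambda>j. y (j + i)) 0 = \<phi> (\<lambda>j. y' (j + i)) 0"
      using y Y.translate[of _ i] by (auto simp: C_def)
    then show "\<phi> y i = \<phi> y' i" using y shift_int by simp
  qed
qed

text \<open>
  Once the overlap is at least as long as every forbidden word, an occurrence of a forbidden word in
  the spliced point lies entirely inside the range where it coincides with \<open>y\<close> or inside the range
  where it coincides with \<open>y'\<close>.
\<close>

lemma splice_shift_of_finite_type:
  assumes "shift_of_finite_type B Y"
  obtains m :: nat where
    "\<And>n y y'. \<lbrakk>m \<le> n; y \<in> Y; y' \<in> Y; \<forall>j\<in>{- int n..int n}. y j = y' j\<rbrakk>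
       \<Longrightarrow> glue (left_ray y) (right_ray y') \<in> Y"
proof -
  from assms obtain F where F: "finite F"
    and Y: "Y = {x \<in> topspace (full_shift B). \<forall>w \<in> F. \<not> occurs_in w x}"
    by (auto simp: shift_of_finite_type_def)
  define m where "m = Max (insert 0 (length ` F))"
  have m: "length w \<le> m" if "w \<in> F" for w using F that by (auto simp: m_def)
  have z: "glue (left_ray y) (right_ray y') = (\<lambda>i. if i \<ge> 0 then y' i else y i)" for y y' :: "int \<Rightarrow> 'a"
    by (auto simp: glue_def left_ray_def right_ray_def fun_eq_iff)
  show ?thesis
  proof (rule that[of m])
    fix n y y' assume a: "m \<le> n" "y \<in> Y" "y' \<in> Y" "\<forall>j\<in>{- int n..int n}. y j = y' j"
    have "\<not> occurs_in w (\<lambda>i. if i \<ge> 0 then y' i else y i)" if w: "w \<in> F" for w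
    proof
      assume "occurs_in w (\<lambda>i. if i \<ge> 0 then y' i else y i)"
      then obtain i where i: "\<forall>k<length w. w ! k = (if i + int k \<ge> 0 then y' (i + int k) else y (i + int k))"
        by (auto simp: occurs_in_def)
      show False
      proof (cases "i \<ge> - int n")
        case True
        then have "\<forall>k<length w. w ! k = y' (i + int k)" using i a(4) by auto
        then have "occurs_in w y'" by (auto simp: occurs_in_def)
        then show False using w a(3) by (auto simp: Y)
      next
        case False
        then have "\<forall>k<length w. w ! k = y (i + int k)" using i m[OF w] a(1) by auto
        then have "occurs_in w y" by (auto simp: occurs_in_def)
        then show False using w a(2) by (auto simp: Y)
      qed
    qed
    then show "glue (left_ray y) (right_ray y') \<in> Y"
      using a(2,3) by (auto simp: z Y topspace_full_shift)
  qed
qed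

text \<open>
  Moves the origin across \<open>w\<close>: the left ray ending just after \<open>w\<close>, against the left ray ending just
  before it. The list is reversed because left rays are read away from the origin.
\<close>

lemma left_ray_translate_eq_conc_iff:
  "left_ray (\<lambda>i. x (i + int (length w))) = rev w \<frown> y \<longleftrightarrow>
     left_ray x = y \<and> (\<forall>k<length w. x (int k) = w ! k)" (is "?L \<longleftrightarrow> ?R")
proof
  assume L: ?L
  have "left_ray x n = y n" for n
    using fun_cong[OF L, of "n + length w"] by (simp add: left_ray_def conc_def)
  moreover have "x (int k) = w ! k" if "k < length w" for k
  proof -
    have "length w - Suc k < length w" using that by simp
    with fun_cong[OF L, of "length w - Suc k"] that show ?thesis
      by (simp add: left_ray_def conc_def rev_nth of_nat_diff)
  qed
  ultimately show ?R by auto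
next
  assume R: ?R
  show ?L
  proof
    fix n
    show "left_ray (\<lambda>i. x (i + int (length w))) n = (rev w \<frown> y) n"
    proof (cases "n < length w")
      case True
      have "length w - Suc n < length w" using True by simp
      with R have "x (int (length w - Suc n)) = w ! (length w - Suc n)" by blast
      moreover have "- int n - 1 + int (length w) = int (length w - Suc n)" using True by simp
      ultimately show ?thesis
        using True by (simp only: left_ray_def conc_def rev_nth length_rev if_True)
    next
      case False
      have "left_ray x (n - length w) = y (n - length w)" using R by simp
      then show ?thesis using False by (simp add: left_ray_def conc_def of_nat_diff algebra_simps)
    qed
  qed
qed

context shift_system
begin

lemma conc_in_left_rays_iff:
  "rev w \<frown> y \<in> left_rays X \<longleftrightarrow> (\<exists>x\<in>X. left_ray x = y \<and> (\<forall>k<length w. x (int k) = w ! k))"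
proof
  assume "rev w \<frown> y \<in> left_rays X"
  then obtain x where x: "x \<in> X" "left_ray x = rev w \<frown> y" by (auto simp: left_rays_def)
  have "left_ray (\<lambda>j. x (j - int (length w))) = y \<and>
      (\<forall>k<length w. x (int k - int (length w)) = w ! k)"
    using left_ray_translate_eq_conc_iff[of "\<lambda>j. x (j - int (length w))" w y] x(2) by simp
  moreover have "(\<lambda>j. x (j - int (length w))) \<in> X" using translate[OF x(1), of "- int (length w)"] by simp
  ultimately show "\<exists>x\<in>X. left_ray x = y \<and> (\<forall>k<length w. x (int k) = w ! k)"
    by (intro bexI[of _ "\<lambda>j. x (j - int (length w))"]) auto
next
  assume "\<exists>x\<in>X. left_ray x = y \<and> (\<forall>k<length w. x (int k) = w ! k)"
  then obtain x where x: "x \<in> X" "left_ray x = y \<and> (\<forall>k<length w. x (int k) = w ! k)" by blast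
  from x(2) have "left_ray (\<lambda>i. x (i + int (length w))) = rev w \<frown> y"
    by (rule iffD2[OF left_ray_translate_eq_conc_iff])
  then show "rev w \<frown> y \<in> left_rays X"
    unfolding left_rays_def using translate[OF x(1)] by (metis imageI)
qed

lemma left_rays_concD:
  assumes "w \<frown> y \<in> left_rays X" shows "y \<in> left_rays X"
  using assms conc_in_left_rays_iff[of "rev w" y] by (auto simp: left_rays_def)

lemma mem_past_word_iff_conc: "y \<in> past_word X w \<longleftrightarrow> rev w \<frown> y \<in> left_rays X"
  using left_rays_concD by (auto simp: past_word_def)

lemma mem_past_word_iff:
  "y \<in> past_word X w \<longleftrightarrow> (\<exists>x\<in>X. left_ray x = y \<and> (\<forall>k<length w. x (int k) = w ! k))"
  by (simp only: mem_past_word_iff_conc conc_in_left_rays_iff)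

end

text \<open>
  Let \<open>\<phi>\<close> present \<open>X\<close> as a factor of a shift of finite type \<open>Y\<close>, and take a window whose radius is at
  least the length of every forbidden word and the radius of \<open>\<phi>\<close>. If \<open>y\<close> and \<open>y'\<close> in \<open>Y\<close> show the
  same window, the left half of \<open>y\<close> can be spliced to the right half of \<open>y'\<close>, and \<open>\<phi>\<close> maps the result to the left half of
  \<open>\<phi> y\<close> followed by the right half of \<open>\<phi> y'\<close>. So \<open>P\<^sub>\<infinity>(w)\<close> is determined by the set of windows of
  points whose image carries \<open>w\<close>, and there are finitely many sets of windows.
\<close>

theorem sofic_finite_past_words:
  assumes "sofic_shift A X"
  shows "finite (range (past_word X))"
proof -
  from assms obtain B :: "nat set" and Y \<phi> where X: "shift_space A X"
    and Y: "shift_of_finite_type B Y"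
    and cont: "continuous_map (subtopology (full_shift B) Y) (full_shift A) \<phi>"
    and comm: "\<And>y. y \<in> Y \<Longrightarrow> \<phi> (shift_map y) = shift_map (\<phi> y)" and img: "\<phi> ` Y = X"
    by (auto simp: sofic_shift_def)
  interpret shift_system A X by standard fact
  interpret Y: shift_system B Y by standard (rule shift_space_of_finite_type[OF Y])
  obtain r :: nat where r: "\<And>y y' i. \<lbrakk>y \<in> Y; y' \<in> Y; \<forall>j\<in>{i - int r..i + int r}. y j = y' j\<rbrakk> \<Longrightarrow> \<phi> y i = \<phi> y' i"
    using sliding_block_code[OF Y.shift_space cont comm] by blast
  obtain m :: nat where m: "\<And>n y y'. \<lbrakk>m \<le> n; y \<in> Y; y' \<in> Y; \<forall>j\<in>{- int n..int n}. y j = y' j\<rbrakk>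
       \<Longrightarrow> glue (left_ray y) (right_ray y') \<in> Y"
    using splice_shift_of_finite_type[OF Y] by blast
  define n where "n = max m r"
  define window where "window = (\<lambda>y::int \<Rightarrow> nat. restrict y {- int n..int n})"
  define G where "G = (\<lambda>T. {left_ray (\<phi> y) | y. y \<in> Y \<and> window y \<in> T})"
  have "past_word X w = G (window ` {y\<in>Y. \<forall>k<length w. \<phi> y (int k) = w ! k})" (is "_ = ?G") for w
  proof
    show "past_word X w \<subseteq> ?G"
    proof
      fix u assume "u \<in> past_word X w"
      then obtain y where "y \<in> Y" "left_ray (\<phi> y) = u" "\<forall>k<length w. \<phi> y (int k) = w ! k"
        unfolding mem_past_word_iff using img by blast
      then show "u \<in> ?G" unfolding G_def by blast
    qed
    show "?G \<subseteq> past_word X w"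
    proof
      fix u assume "u \<in> ?G"
      then obtain y y' where y: "y \<in> Y" "u = left_ray (\<phi> y)" "y' \<in> Y" "window y = window y'"
        "\<forall>k<length w. \<phi> y' (int k) = w ! k"
        unfolding G_def by auto
      have eq: "y j = y' j" if "j \<in> {- int n..int n}" for j
        using fun_cong[OF y(4), of j] that by (simp add: window_def)
      define z where "z = glue (left_ray y) (right_ray y')"
      have zi: "z i = (if i \<ge> 0 then y' i else y i)" for i
        by (auto simp: z_def glue_def left_ray_def right_ray_def)
      have zY: "z \<in> Y" unfolding z_def using eq by (intro m[of n] y) (auto simp: n_def)
      have "\<phi> z i = \<phi> y i" if "i < 0" for i
        using that eq by (intro r zY y) (auto simp: zi n_def)
      then have 1: "left_ray (\<phi> z) = u" by (auto simp: y(2) left_ray_def)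
      have "\<phi> z i = \<phi> y' i" if "i \<ge> 0" for i
        using that eq by (intro r zY y) (auto simp: zi n_def)
      with y(5) have "\<forall>k<length w. \<phi> z (int k) = w ! k" by simp
      with 1 show "u \<in> past_word X w"
        unfolding mem_past_word_iff using zY img by blast
    qed
  qed
  then have "range (past_word X) \<subseteq> G ` Pow (window ` Y)" by blast
  moreover have "window ` Y \<subseteq> PiE {- int n..int n} (\<lambda>_. B)"
    using Y.in_alphabet by (auto simp: window_def)
  then have "finite (window ` Y)"
    by (rule finite_subset) (intro finite_PiE Y.finite_alphabet finite_atLeastAtMost_int)
  ultimately show ?thesis by (meson finite_Pow_iff finite_imageI finite_subset)
qed

section \<open>Past sets of words and of rays\<close>

lemma left_ray_glue [simp]: "left_ray (glue y x) = y"
  by (auto simp: left_ray_def glue_def)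

lemma right_ray_glue [simp]: "right_ray (glue y x) = x"
  by (auto simp: right_ray_def glue_def)

lemma glue_conc: "glue y (w \<frown> x) = (\<lambda>i. glue (rev w \<frown> y) x (i - int (length w)))"
proof
  fix i
  consider "i < 0" | "0 \<le> i" "i < int (length w)" | "int (length w) \<le> i" by linarith
  then show "glue y (w \<frown> x) i = glue (rev w \<frown> y) x (i - int (length w))"
  proof cases
    case 1
    then have "nat (int (length w) - i - 1) = nat (- i - 1) + length w" by simp
    with 1 show ?thesis by (simp add: glue_def conc_def algebra_simps)
  next
    case 2
    define k where "k = nat i"
    with 2 have k: "i = int k" "k < length w" by auto
    have "nat (int (length w) - i - 1) = length w - Suc k" using k by simp
    with k show ?thesis by (auto simp: glue_def conc_def algebra_simps rev_nth)
  next
    case 3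
    then show ?thesis by (simp add: glue_def conc_def nat_diff_distrib nat_less_iff)
  qed
qed

lemma singleton_conc_suffix: "[x 0] \<frown> suffix (Suc 0) x = x"
  by (auto simp: conc_def suffix_def)

text \<open>
  This turns \<open>P\<^sub>\<infinity>\<close> into \<open>P\<^sub>l\<close>, uniformly for words and rays; so equal past sets have equal \<open>P\<^sub>l\<close>, and
  a word can be compared with a ray.
\<close>

definition past_suffixes :: "nat \<Rightarrow> 'a word set \<Rightarrow> 'a list set" where
  "past_suffixes l P = {v. v \<noteq> [] \<and> length v \<le> l \<and> (\<exists>y. rev v \<frown> y \<in> P)}"

lemma past_suffixes_mono: "k \<le> l \<Longrightarrow> past_suffixes k P = {v \<in> past_suffixes l P. length v \<le> k}"
  by (auto simp: past_suffixes_def)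

context shift_system
begin

text \<open>
  Past sets of extended words are computed from past sets alone; this is what allows one word to be
  exchanged for another, or for a ray, with the same past set.
\<close>

lemma past_word_append: "past_word X (v @ w) = {y. rev v \<frown> y \<in> past_word X w}"
  by (auto simp: mem_past_word_iff_conc)

lemma past_word_Cons: "past_word X (a # w) = {y. [a] \<frown> y \<in> past_word X w}"
  using past_word_append[of "[a]" w] by simp

lemma language_subset_lists: "language X \<subseteq> lists A"
proof
  fix w assume "w \<in> language X"
  then obtain x i where "x \<in> X" "\<forall>k<length w. w ! k = x (i + int k)"
    by (auto simp: language_def occurs_in_def)
  then show "w \<in> lists A" using in_alphabet by (auto simp: in_set_conv_nth)
qed

lemma mem_language_iff: "w \<in> language X \<longleftrightarrow> w \<noteq> [] \<and> past_word X w \<noteq> {}"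
proof -
  have "(\<exists>x\<in>X. occurs_in w x) \<longleftrightarrow> (\<exists>x\<in>X. \<forall>k<length w. x (int k) = w ! k)"
  proof
    assume "\<exists>x\<in>X. occurs_in w x"
    then obtain x i where x: "x \<in> X" "\<forall>k<length w. w ! k = x (i + int k)"
      by (auto simp: occurs_in_def)
    then show "\<exists>x\<in>X. \<forall>k<length w. x (int k) = w ! k"
      by (intro bexI[OF _ translate[of x i]]) (simp_all add: add.commute)
  next
    assume "\<exists>x\<in>X. \<forall>k<length w. x (int k) = w ! k"
    then show "\<exists>x\<in>X. occurs_in w x"
      unfolding occurs_in_def by (elim bexE, intro bexI exI[of _ 0]) auto
  qed
  also have "\<dots> \<longleftrightarrow> past_word X w \<noteq> {}"
    using mem_past_word_iff[of _ w] by blast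
  finally show ?thesis by (auto simp: language_def)
qed

lemma mem_past_ray_iff: "y \<in> past_ray X x \<longleftrightarrow> glue y x \<in> X"
  by (auto simp: past_ray_def left_rays_def intro: rev_image_eqI)

lemma right_rays_iff: "x \<in> right_rays X \<longleftrightarrow> past_ray X x \<noteq> {}"
proof
  assume "x \<in> right_rays X"
  then obtain z where "z \<in> X" "x = right_ray z" by (auto simp: right_rays_def)
  then have "left_ray z \<in> past_ray X x" by (simp add: mem_past_ray_iff)
  then show "past_ray X x \<noteq> {}" by blast
next
  assume "past_ray X x \<noteq> {}"
  then obtain y where "glue y x \<in> X" using mem_past_ray_iff by blast
  then have "right_ray (glue y x) \<in> right_rays X" unfolding right_rays_def by (rule imageI)
  then show "x \<in> right_rays X" by simp
qed

lemma past_ray_append: "past_ray X (w \<frown> x) = {y. rev w \<frown> y \<in> past_ray X x}"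
proof -
  have "glue y (w \<frown> x) \<in> X \<longleftrightarrow> glue (rev w \<frown> y) x \<in> X" for y
    using translate_iff[of "glue (rev w \<frown> y) x" "- int (length w)"] by (simp add: glue_conc)
  then show ?thesis by (intro set_eqI) (simp only: mem_past_ray_iff mem_Collect_eq)
qed

lemma past_ray_Cons: "past_ray X ([a] \<frown> x) = {y. [a] \<frown> y \<in> past_ray X x}"
  using past_ray_append[of "[a]" x] by simp

lemma past_word_extend_left:
  assumes "w \<in> language X"
  obtains a where "a # w \<in> language X"
proof -
  from assms obtain y where y: "y \<in> past_word X w" by (auto simp: mem_language_iff)
  have "suffix 1 y \<in> past_word X (y 0 # w)" using y
    by (simp only: past_word_Cons mem_Collect_eq One_nat_def singleton_conc_suffix)
  then have "y 0 # w \<in> language X" by (auto simp: mem_language_iff)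
  then show ?thesis by (rule that)
qed

lemma past_ray_extend_left:
  assumes "x \<in> right_rays X"
  obtains a where "[a] \<frown> x \<in> right_rays X"
proof -
  from assms obtain y where y: "y \<in> past_ray X x" by (auto simp: right_rays_iff)
  have "suffix 1 y \<in> past_ray X ([y 0] \<frown> x)" using y
    by (simp only: past_ray_Cons mem_Collect_eq One_nat_def singleton_conc_suffix)
  then have "[y 0] \<frown> x \<in> right_rays X" by (auto simp: right_rays_iff)
  then show ?thesis by (rule that)
qed

lemma language_ConsD: "a # w \<in> language X \<Longrightarrow> w \<noteq> [] \<Longrightarrow> w \<in> language X"
  by (auto simp: mem_language_iff past_word_Cons)

lemma right_rays_ConsD: "[a] \<frown> x \<in> right_rays X \<Longrightarrow> x \<in> right_rays X"
  unfolding right_rays_iff past_ray_Cons by blast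

lemma past_suffix_in_language:
  assumes "rev v \<frown> y \<in> left_rays X" "v \<noteq> []"
  shows "v \<in> language X"
proof -
  have "y \<in> past_word X v" using assms(1) by (simp only: mem_past_word_iff_conc)
  with assms(2) show ?thesis by (auto simp: mem_language_iff)
qed

lemma lpast_word_eq: "lpast_word X l w = past_suffixes l (past_word X w)"
proof -
  have "v \<in> language X \<and> v @ w \<in> language X \<longleftrightarrow> v \<noteq> [] \<and> (\<exists>y. rev v \<frown> y \<in> past_word X w)" for v
  proof -
    have "(\<exists>y. rev v \<frown> y \<in> past_word X w) \<Longrightarrow> v \<noteq> [] \<Longrightarrow> v \<in> language X"
      using past_suffix_in_language[of v] unfolding past_word_def by blast
    moreover have "v @ w \<in> language X \<longleftrightarrow> v @ w \<noteq> [] \<and> (\<exists>y. rev v \<frown> y \<in> past_word X w)"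
      unfolding mem_language_iff past_word_append by blast
    ultimately show ?thesis by (auto simp: language_def)
  qed
  then show ?thesis by (auto simp: lpast_word_def past_suffixes_def)
qed

lemma lpast_ray_eq: "lpast_ray X l x = past_suffixes l (past_ray X x)"
proof -
  have "v \<in> language X \<and> v \<frown> x \<in> right_rays X \<longleftrightarrow> v \<noteq> [] \<and> (\<exists>y. rev v \<frown> y \<in> past_ray X x)" for v
  proof -
    have "(\<exists>y. rev v \<frown> y \<in> past_ray X x) \<Longrightarrow> v \<noteq> [] \<Longrightarrow> v \<in> language X"
      using past_suffix_in_language[of v] unfolding past_ray_def by blast
    moreover have "v \<frown> x \<in> right_rays X \<longleftrightarrow> (\<exists>y. rev v \<frown> y \<in> past_ray X x)"
      unfolding right_rays_iff past_ray_append by blast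
    ultimately show ?thesis by (auto simp: language_def)
  qed
  then show ?thesis by (auto simp: lpast_ray_def past_suffixes_def)
qed

text \<open>
  Past sets are closed sets of left rays, hence determined by the finite words in which their members
  end.
\<close>

lemma past_word_closed:
  assumes "\<And>n. \<exists>u. prefix n y \<frown> u \<in> past_word X w"
  shows "y \<in> past_word X w"
proof -
  define z where "z = glue (rev w \<frown> y) undefined"
  have "\<exists>x\<in>X. \<forall>i\<in>{- int n..<0}. x i = z i" for n
  proof -
    from assms[of n] obtain u where "rev w \<frown> (prefix n y \<frown> u) \<in> left_rays X"
      unfolding mem_past_word_iff_conc by blast
    then obtain x where x: "x \<in> X" "left_ray x = rev w \<frown> (prefix n y \<frown> u)"
      unfolding left_rays_def by (metis imageE)
    have "x i = z i" if "i \<in> {- int n..<0}" for i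
      using fun_cong[OF x(2), of "nat (- i - 1)"] that
      by (auto simp: z_def glue_def left_ray_def conc_def)
    with x(1) show ?thesis by blast
  qed
  moreover have "incseq (\<lambda>n. {- int n..<0})" by (auto simp: incseq_def)
  ultimately obtain x where x: "x \<in> X" "\<forall>n. \<forall>i\<in>{- int n..<0}. x i = z i"
    using point_agreeing_on_Union by blast
  have "left_ray x n = (rev w \<frown> y) n" for n
    using x(2)[rule_format, of "- int n - 1" "Suc n"] by (simp add: left_ray_def z_def glue_def)
  then have "left_ray x = rev w \<frown> y" by blast
  with x(1) show ?thesis unfolding mem_past_word_iff_conc left_rays_def by (metis imageI)
qed

lemma past_ray_closed:
  assumes "\<And>n. \<exists>u. prefix n y \<frown> u \<in> past_ray X x"
  shows "y \<in> past_ray X x"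
proof -
  have "\<exists>z\<in>X. \<forall>i\<in>{- int n..}. z i = glue y x i" for n
  proof -
    from assms[of n] obtain u where "glue (prefix n y \<frown> u) x \<in> X"
      by (auto simp: mem_past_ray_iff)
    moreover have "\<forall>i\<in>{- int n..}. glue (prefix n y \<frown> u) x i = glue y x i"
      by (auto simp: glue_def conc_def)
    ultimately show ?thesis by blast
  qed
  moreover have "incseq (\<lambda>n. {- int n..})" by (auto simp: incseq_def)
  ultimately obtain z where z: "z \<in> X" "\<forall>n. \<forall>i\<in>{- int n..}. z i = glue y x i"
    using point_agreeing_on_Union by blast
  have "z i = glue y x i" for i
    using z(2)[rule_format, of i "nat \<bar>i\<bar>"] by simp
  then have "z = glue y x" by blast
  with z(1) show ?thesis by (simp add: mem_past_ray_iff)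
qed

text \<open>
  Every left ray in one of the two past sets is approximated by members of the other, and both sets
  are closed.
\<close>

lemma past_word_eq_past_ray_if_suffixes_eq:
  assumes "\<And>l. past_suffixes l (past_word X w) = past_suffixes l (past_ray X x)"
  shows "past_word X w = past_ray X x"
proof -
  have transfer: "\<exists>u. prefix n y \<frown> u \<in> Q"
    if eq: "\<And>l. past_suffixes l P = past_suffixes l Q" and y: "y \<in> P" for P Q :: "'a word set" and y n
  proof -
    have pos: "\<exists>u. prefix m y \<frown> u \<in> Q" if "m > 0" for m
    proof -
      have "rev (prefix m y) \<in> past_suffixes m P"
        unfolding past_suffixes_def using y that
        by (intro CollectI conjI exI[of _ "suffix m y"]) auto
      then have "rev (prefix m y) \<in> past_suffixes m Q" using eq by simp
      then show ?thesis by (simp add: past_suffixes_def)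
    qed
    show ?thesis
    proof (cases "n = 0")
      case True
      obtain u where "prefix 1 y \<frown> u \<in> Q" using pos[of 1] by auto
      then show ?thesis using True by (intro exI[of _ "prefix 1 y \<frown> u"]) simp
    qed (simp add: pos)
  qed
  show ?thesis
  proof
    show "past_word X w \<subseteq> past_ray X x"
      by (intro subsetI past_ray_closed transfer[OF assms])
    show "past_ray X x \<subseteq> past_word X w"
      by (intro subsetI past_word_closed transfer[OF assms[symmetric]])
  qed
qed

lemma mem_past_word_prefix_iff:
  "y \<in> past_word X (prefix n x) \<longleftrightarrow> (\<exists>z\<in>X. \<forall>i\<in>{..<int n}. z i = glue y x i)"
proof -
  have "left_ray z = y \<and> (\<forall>k<length (prefix n x). z (int k) = prefix n x ! k) \<longleftrightarrow>
      (\<forall>i\<in>{..<int n}. z i = glue y x i)" (is "?L \<longleftrightarrow> ?R") for z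
  proof
    assume L: ?L
    show ?R
    proof
      fix i assume i: "i \<in> {..<int n}"
      show "z i = glue y x i"
      proof (cases "i \<ge> 0")
        case True
        then have "nat i < n" using i by simp
        moreover have "\<forall>k<n. z (int k) = x k" using L by simp
        ultimately have "z (int (nat i)) = x (nat i)" by blast
        then show ?thesis using True by (simp add: glue_def)
      next
        case False
        have "left_ray z (nat (- i - 1)) = y (nat (- i - 1))" using L by simp
        then show ?thesis using False by (simp add: glue_def left_ray_def)
      qed
    qed
  next
    assume R: ?R
    have "left_ray z k = y k" for k
      using R[rule_format, of "- int k - 1"] by (simp add: left_ray_def glue_def)
    moreover have "z (int k) = prefix n x ! k" if "k < n" for k
      using R[rule_format, of "int k"] that by (simp add: glue_def subsequence_def)
    ultimately show ?L by auto
  qed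
  then show ?thesis by (simp only: mem_past_word_iff)
qed

end

section \<open>Shifts with finitely many past sets\<close>

locale finite_past_system = shift_system +
  assumes finite_pasts: "finite (range (past_word X))"
begin

text \<open>
  The past sets of the prefixes of \<open>x\<close> decrease and take finitely many values, so they are eventually
  constant; by compactness their intersection is the past set of \<open>x\<close>.
\<close>

lemma past_ray_eq_past_word_prefix:
  obtains N where "\<And>n. N \<le> n \<Longrightarrow> past_word X (prefix n x) = past_ray X x"
proof -
  define f where "f = (\<lambda>n. past_word X (prefix n x))"
  have anti: "f n \<subseteq> f k" if "k \<le> n" for k n
  proof
    fix y assume "y \<in> f n"
    then obtain z where z: "z \<in> X" "\<forall>i\<in>{..<int n}. z i = glue y x i"
      unfolding f_def mem_past_word_prefix_iff by (elim bexE)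
    have "{..<int k} \<subseteq> {..<int n}" using that by simp
    with z(2) have "\<forall>i\<in>{..<int k}. z i = glue y x i" by (metis subsetD)
    with z(1) show "y \<in> f k" unfolding f_def mem_past_word_prefix_iff by blast
  qed
  have "finite (range f)" by (rule finite_subset[OF _ finite_pasts]) (auto simp: f_def)
  then obtain N where N: "infinite {n. f n = f N}"
    using pigeonhole_infinite[of "UNIV :: nat set" f] by auto
  have stable: "f n = f N" if n: "N \<le> n" for n
  proof -
    obtain k where "f k = f N" "n \<le> k" using N unfolding infinite_nat_iff_unbounded_le by blast
    then show ?thesis using anti[of n k] anti[of N n] n by simp
  qed
  have "f N = past_ray X x"
  proof
    show "f N \<subseteq> past_ray X x"
    proof
      fix y assume y: "y \<in> f N"
      have "y \<in> f n" for n using y stable[of n] anti[of n N] by (cases "N \<le> n") auto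
      then have "\<exists>z\<in>X. \<forall>i\<in>{..<int n}. z i = glue y x i" for n
        by (simp add: f_def mem_past_word_prefix_iff)
      moreover have "incseq (\<lambda>n. {..<int n})" by (auto simp: incseq_def)
      ultimately obtain z where z: "z \<in> X" "\<forall>n. \<forall>i\<in>{..<int n}. z i = glue y x i"
        using point_agreeing_on_Union by blast
      have "z i = glue y x i" for i
        using z(2)[rule_format, of i "Suc (nat \<bar>i\<bar>)"] by simp
      then have "z = glue y x" by blast
      with z(1) show "y \<in> past_ray X x" by (simp add: mem_past_ray_iff)
    qed
    show "past_ray X x \<subseteq> f N"
      by (auto simp: f_def mem_past_word_prefix_iff mem_past_ray_iff)
  qed
  with stable have "f n = past_ray X x" if "N \<le> n" for n using that by (metis (no_types))
  then show ?thesis unfolding f_def by (rule that)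
qed

lemma past_ray_is_past_word:
  assumes "x \<in> right_rays X"
  obtains w where "w \<in> language X" "past_word X w = past_ray X x"
proof -
  obtain N where N: "\<And>n. N \<le> n \<Longrightarrow> past_word X (prefix n x) = past_ray X x"
    using past_ray_eq_past_word_prefix by blast
  from N[of "Suc N"] have "past_word X (prefix (Suc N) x) = past_ray X x" by simp
  moreover from this have "prefix (Suc N) x \<in> language X"
    using assms by (simp add: mem_language_iff right_rays_iff)
  ultimately show ?thesis by (intro that)
qed

text \<open>
  These sets mediate between the two sides: they will turn out to be the vertices of the largest
  essential subgraph of the past set cover.
\<close>

definition recurrent_pasts :: "'a word set set" where
  "recurrent_pasts = {P. infinite {w \<in> language X. past_word X w = P}}"

lemma recurrent_pastsE:
  assumes "P \<in> recurrent_pasts"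
  obtains w where "w \<in> language X" "past_word X w = P"
proof (rule ccontr)
  assume "\<not> thesis"
  with that have "{w \<in> language X. past_word X w = P} = {}" by auto
  moreover have "infinite {w \<in> language X. past_word X w = P}"
    using assms by (simp add: recurrent_pasts_def)
  ultimately show False by (metis finite.emptyI)
qed

lemma infinite_set_meets_recurrent_pasts:
  assumes "infinite F" "F \<subseteq> language X"
  obtains w where "w \<in> F" "past_word X w \<in> recurrent_pasts"
proof -
  have "finite (past_word X ` F)" by (rule finite_subset[OF _ finite_pasts]) auto
  from pigeonhole_infinite[OF assms(1) this] obtain w
    where w: "w \<in> F" "infinite {v\<in>F. past_word X v = past_word X w}" by (elim bexE)
  have "infinite {v \<in> language X. past_word X v = past_word X w}"
    by (rule infinite_super[OF _ w(2)]) (use assms(2) in auto)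
  with w(1) show ?thesis by (intro that) (auto simp: recurrent_pasts_def)
qed

lemma condition_star_iff: "condition_star X \<longleftrightarrow> recurrent_pasts \<subseteq> past_ray X ` right_rays X"
proof
  assume star: "condition_star X"
  show "recurrent_pasts \<subseteq> past_ray X ` right_rays X"
  proof
    fix P assume P: "P \<in> recurrent_pasts"
    define F where "F = {w \<in> language X. past_word X w = P}"
    have F: "infinite F" "F \<subseteq> language X" using P by (auto simp: F_def recurrent_pasts_def)
    then obtain w where w: "w \<in> F" by (metis finite.emptyI all_not_in_conv)
    then have wP: "past_word X w = P" by (simp add: F_def)
    have "\<exists>x. x \<in> right_rays X \<and> past_suffixes l (past_word X w) = past_suffixes l (past_ray X x)" for l
    proof -
      have eq: "\<forall>u\<in>F. \<forall>v\<in>F. lpast_word X l u = lpast_word X l v"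
        by (auto simp: F_def lpast_word_eq)
      from star[unfolded condition_star_def, THEN spec[of _ l], THEN spec[of _ F]]
        conjI[OF F(2) conjI[OF F(1) eq]]
      have "\<exists>x\<in>right_rays X. \<forall>w\<in>F. lpast_word X l w = lpast_ray X l x" by (rule mp)
      then show ?thesis using w unfolding lpast_word_eq lpast_ray_eq by blast
    qed
    then have "\<forall>l. \<exists>x. x \<in> right_rays X \<and> past_suffixes l (past_word X w) = past_suffixes l (past_ray X x)"
      by (rule allI)
    \<comment> \<open>The ray depends on \<open>l\<close>, but its past set takes only finitely many values; a value attained
      for infinitely many \<open>l\<close> has the right \<open>P\<^sub>l\<close> for every \<open>l\<close>, since \<open>P\<^sub>l\<close> is cut out of any later
      \<open>P\<^sub>m\<close> by length.\<close>
    from choice[OF this] obtain x where x: "\<And>l. x l \<in> right_rays X"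
      and eq: "\<And>l. past_suffixes l (past_word X w) = past_suffixes l (past_ray X (x l))" by blast
    have "range (\<lambda>l. past_ray X (x l)) \<subseteq> range (past_word X)"
      using past_ray_is_past_word[OF x] by (metis image_subsetI rangeI)
    then have "finite (range (\<lambda>l. past_ray X (x l)))" using finite_pasts finite_subset by blast
    then obtain k where k: "infinite {l. past_ray X (x l) = past_ray X (x k)}"
      using pigeonhole_infinite[of "UNIV :: nat set" "\<lambda>l. past_ray X (x l)"] by auto
    have "past_suffixes l (past_word X w) = past_suffixes l (past_ray X (x k))" for l
    proof -
      obtain m where "l \<le> m" "past_ray X (x m) = past_ray X (x k)"
        using k unfolding infinite_nat_iff_unbounded_le by blast
      then show ?thesis using eq[of m] by (simp add: past_suffixes_mono[of l m])
    qed
    then have "past_word X w = past_ray X (x k)"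
      by (rule past_word_eq_past_ray_if_suffixes_eq)
    with wP x show "P \<in> past_ray X ` right_rays X" by auto
  qed
next
  assume sub: "recurrent_pasts \<subseteq> past_ray X ` right_rays X"
  show "condition_star X"
    unfolding condition_star_def
  proof (intro allI impI)
    fix l F
    assume "F \<subseteq> language X \<and> infinite F \<and> (\<forall>u \<in> F. \<forall>v \<in> F. lpast_word X l u = lpast_word X l v)"
    then have F: "F \<subseteq> language X" "infinite F"
      and eq: "\<forall>u\<in>F. \<forall>v\<in>F. lpast_word X l u = lpast_word X l v" by iprover+
    obtain w where w: "w \<in> F" "past_word X w \<in> recurrent_pasts"
      using infinite_set_meets_recurrent_pasts[OF F(2,1)] by blast
    with sub obtain x where x: "x \<in> right_rays X" "past_word X w = past_ray X x" by blast
    have "\<forall>v\<in>F. lpast_word X l v = lpast_ray X l x"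
      using eq[rule_format, OF _ w(1)] x(2) by (simp add: lpast_word_eq lpast_ray_eq)
    with x(1) show "\<exists>x\<in>right_rays X. \<forall>w\<in>F. lpast_word X l w = lpast_ray X l x" by blast
  qed
qed

end

section \<open>Essential subgraphs of the past set cover\<close>

lemma labelled_graph_simps [simp]:
  "verts (labelled_graph V E) = V" "arcs (labelled_graph V E) = E"
  "tail (labelled_graph V E) (p, a, q) = p" "head (labelled_graph V E) (p, a, q) = q"
  by (simp_all add: labelled_graph_def)

lemma compatible_labelled_graph:
  "compatible (labelled_graph V E) (labelled_graph V' E')"
  by (simp add: compatible_def labelled_graph_def)

lemma wf_labelled_graph:
  assumes "\<And>p a q. (p, a, q) \<in> E \<Longrightarrow> p \<in> V \<and> q \<in> V"
  shows "wf_digraph (labelled_graph V E)"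
proof
  fix e assume "e \<in> arcs (labelled_graph V E)"
  then obtain p a q where "e = (p, a, q)" "(p, a, q) \<in> E" by (cases e) simp
  with assms show "tail (labelled_graph V E) e \<in> verts (labelled_graph V E)"
    "head (labelled_graph V E) e \<in> verts (labelled_graph V E)" by simp_all
qed

lemma essential_labelled_graph_iff:
  "essential (labelled_graph V E) \<longleftrightarrow> (\<forall>v\<in>V. (\<exists>a q. (v, a, q) \<in> E) \<and> (\<exists>a p. (p, a, v) \<in> E))"
proof -
  have "out_arcs (labelled_graph V E) v \<noteq> {} \<longleftrightarrow> (\<exists>a q. (v, a, q) \<in> E)"
    and "in_arcs (labelled_graph V E) v \<noteq> {} \<longleftrightarrow> (\<exists>a p. (p, a, v) \<in> E)" for v
    by (auto simp: out_arcs_def in_arcs_def)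
  then show ?thesis by (simp add: essential_def)
qed

lemma subgraph_labelled_graphE:
  assumes "subgraph H (labelled_graph V E)"
  obtains V' E' where "H = labelled_graph V' E'" "V' \<subseteq> V" "E' \<subseteq> E"
    "\<And>p a q. (p, a, q) \<in> E' \<Longrightarrow> p \<in> V' \<and> q \<in> V'"
proof (rule that[of "verts H" "arcs H"])
  have eqs: "tail H = (\<lambda>(p, a, q). p)" "head H = (\<lambda>(p, a, q). q)" and wf: "wf_digraph H"
    using assms by (auto simp: subgraph_def compatible_def labelled_graph_def)
  show "H = labelled_graph (verts H) (arcs H)"
    using eqs by (simp add: labelled_graph_def)
  show "verts H \<subseteq> V" "arcs H \<subseteq> E" using assms by (auto simp: subgraph_def)
  show "p \<in> verts H \<and> q \<in> verts H" if "(p, a, q) \<in> arcs H" for p a q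
    using wf_digraph.tail_in_verts[OF wf that] wf_digraph.head_in_verts[OF wf that] eqs by simp
qed

context finite_past_system
begin

lemma wf_past_set_cover: "wf_digraph (past_set_cover X)"
  unfolding past_set_cover_def by (rule wf_labelled_graph) auto

lemma wf_left_krieger_cover: "wf_digraph (left_krieger_cover X)"
  unfolding left_krieger_cover_def by (rule wf_labelled_graph) auto

lemma subgraph_krieger_past_set_cover: "subgraph (left_krieger_cover X) (past_set_cover X)"
proof -
  have "past_ray X x \<in> past_word X ` language X" if "x \<in> right_rays X" for x
    using past_ray_is_past_word[OF that] by (metis imageI)
  then have "verts (left_krieger_cover X) \<subseteq> verts (past_set_cover X)"
    by (auto simp: left_krieger_cover_def past_set_cover_def)
  moreover have "arcs (left_krieger_cover X) \<subseteq> arcs (past_set_cover X)"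
  proof
    fix e assume "e \<in> arcs (left_krieger_cover X)"
    then obtain a x where e: "e = (past_ray X ([a] \<frown> x), a, past_ray X x)"
      and x: "x \<in> right_rays X" "[a] \<frown> x \<in> right_rays X" by (auto simp: left_krieger_cover_def)
    obtain w where w: "w \<in> language X" "past_word X w = past_ray X x"
      using past_ray_is_past_word[OF x(1)] by blast
    have aw: "past_word X (a # w) = past_ray X ([a] \<frown> x)"
      unfolding past_word_Cons past_ray_Cons w(2) ..
    then have "a # w \<in> language X" using x(2) by (simp add: mem_language_iff right_rays_iff)
    then show "e \<in> arcs (past_set_cover X)"
      unfolding e past_set_cover_def using w aw by (auto intro!: exI[of _ w])
  qed
  ultimately show ?thesis
    using wf_past_set_cover wf_left_krieger_cover compatible_labelled_graph
    by (auto simp: subgraph_def left_krieger_cover_def past_set_cover_def)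
qed

lemma essential_left_krieger_cover: "essential (left_krieger_cover X)"
  unfolding left_krieger_cover_def essential_labelled_graph_iff
proof (intro ballI conjI)
  fix P assume "P \<in> past_ray X ` right_rays X"
  then obtain x where x: "x \<in> right_rays X" "P = past_ray X x" by blast
  from x(1) have "[x 0] \<frown> suffix (Suc 0) x \<in> right_rays X" by (simp only: singleton_conc_suffix)
  with right_rays_ConsD[OF this] x(2)
  show "\<exists>a q. (P, a, q) \<in> {(past_ray X ([a] \<frown> x), a, past_ray X x) |a x.
          x \<in> right_rays X \<and> [a] \<frown> x \<in> right_rays X}"
    by (intro exI[of _ "x 0"] exI[of _ "past_ray X (suffix (Suc 0) x)"] CollectI
        exI[of _ "suffix (Suc 0) x"]) (simp add: singleton_conc_suffix)
  obtain a where "[a] \<frown> x \<in> right_rays X" using past_ray_extend_left[OF x(1)] by blast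
  with x show "\<exists>a p. (p, a, P) \<in> {(past_ray X ([a] \<frown> x), a, past_ray X x) |a x.
          x \<in> right_rays X \<and> [a] \<frown> x \<in> right_rays X}"
    by blast
qed

definition recurrent_edges :: "('a word set \<times> 'a \<times> 'a word set) set" where
  "recurrent_edges = {(P, a, Q) \<in> arcs (past_set_cover X). P \<in> recurrent_pasts \<and> Q \<in> recurrent_pasts}"

lemma subgraph_recurrent: "subgraph (labelled_graph recurrent_pasts recurrent_edges) (past_set_cover X)"
proof -
  have "P \<in> past_word X ` language X" if "P \<in> recurrent_pasts" for P
    using recurrent_pastsE[OF that] by blast
  then have "recurrent_pasts \<subseteq> verts (past_set_cover X)" by (auto simp: past_set_cover_def)
  moreover have "recurrent_edges \<subseteq> arcs (past_set_cover X)" by (auto simp: recurrent_edges_def)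
  moreover have "wf_digraph (labelled_graph recurrent_pasts recurrent_edges)"
    by (rule wf_labelled_graph) (auto simp: recurrent_edges_def)
  ultimately show ?thesis
    using wf_past_set_cover compatible_labelled_graph
    by (auto simp: subgraph_def past_set_cover_def)
qed

text \<open>
  Infinitely many words with past set \<open>P\<close> are of the form \<open>a u\<close>, and infinitely many of these share
  both \<open>a\<close> and the past set of \<open>u\<close>: that past set is recurrent and ends an edge leaving \<open>P\<close>. Conversely,
  a letter that can be put before one word with past set \<open>P\<close> can be put before all of them, with the
  same resulting past set, and this gives an edge entering \<open>P\<close>.
\<close>

lemma essential_recurrent: "essential (labelled_graph recurrent_pasts recurrent_edges)"
  unfolding essential_labelled_graph_iff
proof (intro ballI conjI)
  fix P assume P: "P \<in> recurrent_pasts"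
  define F where "F = {w \<in> language X. past_word X w = P}"
  have F: "infinite F" using P by (simp add: F_def recurrent_pasts_def)
  \<comment> \<open>One-letter words must be excluded, since the empty word is not a word of the language.\<close>
  define F' where "F' = {w \<in> F. tl w \<noteq> []}"
  have F': "infinite F'"
  proof
    assume "finite F'"
    moreover have "F - F' \<subseteq> (\<lambda>a. [a]) ` A"
    proof
      fix w assume w: "w \<in> F - F'"
      then have "w \<in> language X" "tl w = []" by (auto simp: F_def F'_def)
      then have "w \<noteq> []" "tl w = []" "w \<in> lists A"
        using language_subset_lists by (blast dest: mem_language_iff[THEN iffD1])+
      then show "w \<in> (\<lambda>a. [a]) ` A" by (cases w) auto
    qed
    then have "finite (F - F')" by (rule finite_subset) (simp add: finite_alphabet)
    ultimately have "finite (F - F' \<union> F')" by simp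
    then show False using F by (auto simp: F'_def elim: contrapos_np intro: finite_subset[rotated])
  qed
  have "(\<lambda>w. (hd w, past_word X (tl w))) ` F' \<subseteq> A \<times> range (past_word X)"
  proof clarify
    fix w assume "w \<in> F'"
    then have "w \<noteq> []" "w \<in> lists A"
      using language_subset_lists by (auto simp: F_def F'_def)
    then show "hd w \<in> A \<and> past_word X (tl w) \<in> range (past_word X)" by (cases w) auto
  qed
  then have "finite ((\<lambda>w. (hd w, past_word X (tl w))) ` F')"
    by (rule finite_subset) (simp add: finite_alphabet finite_pasts)
  from pigeonhole_infinite[OF F' this] obtain v where v: "v \<in> F'"
    "infinite {w\<in>F'. hd w = hd v \<and> past_word X (tl w) = past_word X (tl v)}" by auto
  define S where "S = {w\<in>F'. hd w = hd v \<and> past_word X (tl w) = past_word X (tl v)}"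
  have S: "w = hd v # tl w \<and> w \<in> language X \<and> tl w \<in> language X" if "w \<in> S" for w
    using that language_ConsD[of "hd w" "tl w"]
    by (cases w) (auto simp: S_def F'_def F_def)
  have "inj_on tl S" by (rule inj_onI) (metis S)
  then have "infinite (tl ` S)" using v(2) by (simp add: finite_image_iff S_def)
  then have "infinite {w \<in> language X. past_word X w = past_word X (tl v)}"
    by (rule infinite_super[rotated]) (use S in \<open>auto simp: S_def\<close>)
  then have "past_word X (tl v) \<in> recurrent_pasts" by (simp add: recurrent_pasts_def)
  moreover have "v \<in> S" using v(1) by (simp add: S_def)
  then obtain a u where u: "v = a # u" "a # u \<in> language X" "u \<in> language X"
    using S[of v] by (metis list.sel(3))
  moreover have "past_word X (a # u) = P" using v(1) u(1) by (simp add: F'_def F_def)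
  ultimately have "(P, a, past_word X u) \<in> recurrent_edges"
    using P by (auto simp: recurrent_edges_def past_set_cover_def)
  then show "\<exists>a q. (P, a, q) \<in> recurrent_edges" by blast
next
  fix P assume P: "P \<in> recurrent_pasts"
  define F where "F = {w \<in> language X. past_word X w = P}"
  have F: "infinite F" using P by (simp add: F_def recurrent_pasts_def)
  obtain w where w: "w \<in> language X" "past_word X w = P" using P by (rule recurrent_pastsE)
  obtain a where a: "a # w \<in> language X" using past_word_extend_left[OF w(1)] by blast
  have "infinite ((#) a ` F)" using F by (simp add: finite_image_iff)
  moreover have "(#) a ` F \<subseteq> {v \<in> language X. past_word X v = past_word X (a # w)}"
  proof
    fix v assume "v \<in> (#) a ` F"
    then obtain u where u: "v = a # u" "past_word X u = past_word X w" using w(2) by (auto simp: F_def)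
    then have "past_word X v = past_word X (a # w)" unfolding u(1) past_word_Cons by simp
    moreover from this a have "v \<in> language X" using u(1) unfolding mem_language_iff by simp
    ultimately show "v \<in> {v \<in> language X. past_word X v = past_word X (a # w)}" by simp
  qed
  ultimately have "past_word X (a # w) \<in> recurrent_pasts"
    unfolding recurrent_pasts_def using infinite_super by blast
  then have "(past_word X (a # w), a, P) \<in> recurrent_edges"
    using P a w by (auto simp: recurrent_edges_def past_set_cover_def)
  then show "\<exists>a p. (p, a, P) \<in> recurrent_edges" by blast
qed

text \<open>
  Following \<open>n\<close> edges forward from a vertex \<open>P\<close> of \<open>H\<close> and prefixing the labels to a word representing
  the end point shows that \<open>P\<close> is the past set of a word with at least \<open>n\<close> letters. Each edge may
  carry its own representing word; these are interchangeable because only past sets matter.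
\<close>

lemma essential_subgraph_recurrent:
  assumes "subgraph H (past_set_cover X)" "essential H"
  shows "verts H \<subseteq> recurrent_pasts"
proof -
  obtain V E where H: "H = labelled_graph V E" and V: "V \<subseteq> past_word X ` language X"
    and E: "E \<subseteq> {(past_word X (a # w), a, past_word X w) |a w. w \<in> language X \<and> a # w \<in> language X}"
    and wf: "\<And>p a q. (p, a, q) \<in> E \<Longrightarrow> p \<in> V \<and> q \<in> V"
    using assms(1) unfolding past_set_cover_def by (rule subgraph_labelled_graphE) blast
  have ess: "\<exists>a q. (v, a, q) \<in> E" if "v \<in> V" for v
    using assms(2) that unfolding H essential_labelled_graph_iff by blast
  have long: "\<forall>P\<in>V. \<exists>w\<in>language X. past_word X w = P \<and> n \<le> length w" for n
  proof (induction n)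
    case 0
    then show ?case using V by auto
  next
    case (Suc n)
    show ?case
    proof
      fix P assume "P \<in> V"
      then obtain a Q where PQ: "(P, a, Q) \<in> E" using ess by blast
      then obtain u where u: "P = past_word X (a # u)" "Q = past_word X u" "a # u \<in> language X"
        using E by blast
      obtain w where w: "w \<in> language X" "past_word X w = Q" "n \<le> length w"
        using Suc wf[OF PQ] by blast
      have "past_word X (a # w) = P" using u w(2) by (simp add: past_word_Cons)
      moreover from this have "a # w \<in> language X" using u by (simp add: mem_language_iff)
      ultimately show "\<exists>w\<in>language X. past_word X w = P \<and> Suc n \<le> length w"
        using w(3) by (intro bexI[of _ "a # w"]) auto
    qed
  qed
  have "P \<in> recurrent_pasts" if "P \<in> V" for P
  proof -
    have "infinite (length ` {w \<in> language X. past_word X w = P})"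
      unfolding infinite_nat_iff_unbounded_le using long that by blast
    then show ?thesis by (auto simp: recurrent_pasts_def)
  qed
  then show ?thesis by (auto simp: H)
qed

text \<open>
  The condition on vertices suffices: if an edge of the past set cover ends in the past set of a ray,
  prefixing its label to that ray shows that it is an edge of the left Krieger cover.
\<close>

lemma subgraph_krieger_if_verts:
  assumes "subgraph H (past_set_cover X)" "verts H \<subseteq> past_ray X ` right_rays X"
  shows "subgraph H (left_krieger_cover X)"
proof -
  obtain V E where H: "H = labelled_graph V E"
    and E: "E \<subseteq> {(past_word X (a # w), a, past_word X w) |a w. w \<in> language X \<and> a # w \<in> language X}"
    and wf: "\<And>p a q. (p, a, q) \<in> E \<Longrightarrow> p \<in> V \<and> q \<in> V"
    using assms(1) unfolding past_set_cover_def by (rule subgraph_labelled_graphE) blast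
  have "arcs H \<subseteq> arcs (left_krieger_cover X)"
  proof
    fix e assume e: "e \<in> arcs H"
    then obtain a w where w: "e = (past_word X (a # w), a, past_word X w)" "a # w \<in> language X"
      using E H by auto
    have "past_word X w \<in> V" using e w(1) wf by (simp add: H)
    with assms(2) obtain x where x: "x \<in> right_rays X" "past_word X w = past_ray X x"
      by (auto simp: H)
    have "past_word X (a # w) = past_ray X ([a] \<frown> x)"
      unfolding past_word_Cons past_ray_Cons x(2) ..
    moreover from this have "[a] \<frown> x \<in> right_rays X"
      using w(2) by (simp add: mem_language_iff right_rays_iff)
    ultimately show "e \<in> arcs (left_krieger_cover X)"
      using w(1) x by (auto simp: left_krieger_cover_def)
  qed
  moreover have "wf_digraph H" using assms(1) by (simp add: subgraph_def)
  ultimately show ?thesis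
    using assms(2) wf_left_krieger_cover compatible_labelled_graph
    by (auto simp: subgraph_def H left_krieger_cover_def)
qed

lemma maximal_essential_iff:
  "is_maximal_essential_subgraph (left_krieger_cover X) (past_set_cover X) \<longleftrightarrow>
     recurrent_pasts \<subseteq> past_ray X ` right_rays X"
proof
  assume "is_maximal_essential_subgraph (left_krieger_cover X) (past_set_cover X)"
  then have "subgraph (labelled_graph recurrent_pasts recurrent_edges) (left_krieger_cover X)"
    using subgraph_recurrent essential_recurrent by (simp add: is_maximal_essential_subgraph_def)
  then show "recurrent_pasts \<subseteq> past_ray X ` right_rays X"
    by (simp add: subgraph_def left_krieger_cover_def)
next
  assume "recurrent_pasts \<subseteq> past_ray X ` right_rays X"
  then show "is_maximal_essential_subgraph (left_krieger_cover X) (past_set_cover X)"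
    unfolding is_maximal_essential_subgraph_def
    by (intro conjI allI impI subgraph_krieger_past_set_cover essential_left_krieger_cover
        subgraph_krieger_if_verts order_trans[OF essential_subgraph_recurrent]) simp_all
qed

end

theorem proposition6p4:
  fixes A :: "'a set" and X :: "(int \<Rightarrow> 'a) set"
  assumes "sofic_shift A X"
  shows "condition_star X \<longleftrightarrow>
    is_maximal_essential_subgraph (left_krieger_cover X) (past_set_cover X)"
proof -
  interpret finite_past_system A X
    using assms sofic_finite_past_words[OF assms] by unfold_locales (auto simp: sofic_shift_def)
  show ?thesis by (simp only: condition_star_iff maximal_essential_iff)
qed

end
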